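(* Consider $\mathsf{maxQPE}_{N,\delta}$ with advice given as at most $t$ applications of an advice unitary (and its inverse) preparing a state of overlap at least $\gamma$, where $N\ge2$, $\gamma\in[1/\sqrt N,1]$, $\delta\in(0,1)$ and $t=\Omega(1/\gamma)$. Then every algorithm solving this task in the known-eigenbasis case (and hence also every algorithm solving it in the unknown-eigenbasis case) has cost $\Omega\left(\frac{1}{\gamma\delta}\right)$. Precisely: for every $a>0$ there is $c>0$ such that for all integers $N\ge2$, all $\gamma\in[1/\sqrt N,1]$, all $\delta\in(0,1)$ and all integers $t\ge a/\gamma$, every such algorithm has cost at least $\frac{c}{\gamma\delta}$.
   Context: Model of computation. The input is an unknown $N$-dimensional unitary $U$. The state space is $\mathbb{C}^N\otimes W$, where the first register is $N$-dimensional with computational basis $|0\rangle,\dots,|N-1\rangle$ and $W$ is an arbitrarily large (finite-dimensional) workspace. The algorithm starts in $|0\rangle|0\rangle$; it may apply $U$ and $U^{-1}$ to the first register (possibly controlled by a qubit of the workspace), and arbitrary unitaries independent of $U$ to the whole space, and it may use the advice unitary as described below; at the end it performs a POVM (independent of $U$) which determines the classical output. The cost of the algorithm is the total number of applications of $U$ and $U^{-1}$ (including controlled versions); all other operations, including uses of the advice unitary, do not count towards the cost. The task $\mathsf{maxQPE}_{N,\delta}$ with $t$ accesses to an advice unitary of overlap at least $\gamma$. Let $U=\sum_{j=0}^{N-1}e^{i\theta_j}|u_j\rangle\langle u_j|$ with orthonormal eigenbasis $(|u_j\rangle)$ and $\theta_j\in[0,2\pi)$, let $\theta_{\max}=\max_j\theta_j$,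 and let $S$ be the span of all eigenstates with eigenphase $\theta_{\max}$. Input promise: $\theta_{\max}\in[0,2\pi-2\delta)$. In the known-eigenbasis case $U$ is moreover promised to be diagonal in the computational basis ($|u_j\rangle=|j\rangle$); in the unknown-eigenbasis case the eigenbasis is arbitrary and unknown. Advice: the algorithm has black-box access to a unitary $A$ with $A|0\rangle=|\alpha\rangle$, where $\|P_S|\alpha\rangle\|^2\ge\gamma^2$ and $P_S$ is the orthogonal projection onto $S$; it may apply $A$ and $A^{-1}$ at most $t$ times in total. Output: with probability at least $2/3$, a value in $[\theta_{\max}-\delta,\theta_{\max}+\delta]$ modulo $2\pi$. The algorithm (which may depend on $N,\delta,\gamma,t$) must be correct for every $U$ satisfying the promise and every valid $A$. *)

theory Defs
  imports Complex_Main "Jordan_Normal_Form.Schur_Decomposition" "Jordan_Normal_Form.VS_Connect"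
begin

definition unitary_mat :: "nat \<Rightarrow> complex mat \<Rightarrow> bool" where
  "unitary_mat n V \<longleftrightarrow>
     V \<in> carrier_mat n n \<and> mat_adjoint V * V = 1\<^sub>m n \<and> V * mat_adjoint V = 1\<^sub>m n"

definition psd_mat :: "nat \<Rightarrow> complex mat \<Rightarrow> bool" where
  "psd_mat n E \<longleftrightarrow>
     E \<in> carrier_mat n n \<and> mat_adjoint E = E \<and>
     (\<forall>v\<in>carrier_vec n. 0 \<le> Re ((E *\<^sub>v v) \<bullet>c v))"

definition sqnorm :: "complex vec \<Rightarrow> real" where
  "sqnorm v = (\<Sum>i<dim_vec v. (cmod (v $ i))\<^sup>2)"

text \<open>
  The state space is the tensor product of an N-dimensional register with an m-dimensional
  workspace W; the basis state |x>|w> (x < N, w < m) has index x * m + w.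

  \<open>Some q\<close> designates the qubit that is the middle factor of a factorisation of W into
  factors of dimensions p, 2, q (so m = p * 2 * q): on |w> it has the value
  (w div q) mod 2.  Since arbitrary unitaries on the whole space are free, this loses no
  generality over other ways of singling out a qubit of W.  \<open>None\<close> means no control.
\<close>
type_synonym control = "nat option"

definition control_ok :: "nat \<Rightarrow> control \<Rightarrow> bool" where
  "control_ok m ctl \<longleftrightarrow> (case ctl of None \<Rightarrow> True | Some q \<Rightarrow> 0 < q \<and> 2 * q dvd m)"

definition control_active :: "control \<Rightarrow> nat \<Rightarrow> bool" where
  "control_active ctl w \<longleftrightarrow> (case ctl of None \<Rightarrow> True | Some q \<Rightarrow> (w div q) mod 2 = 1)"

definition on_register :: "nat \<Rightarrow> nat \<Rightarrow> control \<Rightarrow> complex mat \<Rightarrow> complex mat" where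
  "on_register N m ctl V = mat (N * m) (N * m) (\<lambda>(i, j).
     if i mod m \<noteq> j mod m then 0
     else if control_active ctl (i mod m) then V $$ (i div m, j div m)
     else if i = j then 1 else 0)"

text \<open>
  The Boolean argument of the two oracle operations is true iff the inverse (adjoint) of the
  oracle is applied.  Controlled uses of the advice unitary are allowed as well; this
  only enlarges the class of algorithms.
\<close>
datatype operation =
    Free "complex mat"
  | Input_Query bool control
  | Advice_Query bool control

fun operation_ok :: "nat \<Rightarrow> nat \<Rightarrow> operation \<Rightarrow> bool" where
  "operation_ok N m (Free V) = unitary_mat (N * m) V"
| "operation_ok N m (Input_Query b ctl) = control_ok m ctl"
| "operation_ok N m (Advice_Query b ctl) = control_ok m ctl"

fun operation_mat ::
    "nat \<Rightarrow> nat \<Rightarrow> complex mat \<Rightarrow> complex mat \<Rightarrow> operation \<Rightarrow> complex mat" where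
  "operation_mat N m U A (Free V) = V"
| "operation_mat N m U A (Input_Query b ctl) =
     on_register N m ctl (if b then mat_adjoint U else U)"
| "operation_mat N m U A (Advice_Query b ctl) =
     on_register N m ctl (if b then mat_adjoint A else A)"

text \<open>
  The final measurement is a finite list of POVM elements, each paired with the real number
  that is output when this outcome occurs.
\<close>
record algorithm =
  work_dim :: nat
  operations :: "operation list"
  measurement :: "(complex mat \<times> real) list"

definition is_povm :: "nat \<Rightarrow> complex mat list \<Rightarrow> bool" where
  "is_povm n Es \<longleftrightarrow> (\<forall>E\<in>set Es. psd_mat n E) \<and> foldr (+) Es (0\<^sub>m n n) = 1\<^sub>m n"

definition algorithm_ok :: "nat \<Rightarrow> algorithm \<Rightarrow> bool" where
  "algorithm_ok N alg \<longleftrightarrow>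
     0 < work_dim alg \<and>
     (\<forall>p\<in>set (operations alg). operation_ok N (work_dim alg) p) \<and>
     is_povm (N * work_dim alg) (map fst (measurement alg))"

definition final_state :: "nat \<Rightarrow> complex mat \<Rightarrow> complex mat \<Rightarrow> algorithm \<Rightarrow> complex vec" where
  "final_state N U A alg =
     foldl (\<lambda>\<psi> p. operation_mat N (work_dim alg) U A p *\<^sub>v \<psi>)
       (unit_vec (N * work_dim alg) 0) (operations alg)"

definition output_prob ::
    "nat \<Rightarrow> complex mat \<Rightarrow> complex mat \<Rightarrow> algorithm \<Rightarrow> real set \<Rightarrow> real" where
  "output_prob N U A alg X =
     (\<Sum>(E, x)\<leftarrow>measurement alg.
        if x \<in> X then Re ((E *\<^sub>v final_state N U A alg) \<bullet>c final_state N U A alg) else 0)"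

fun is_input_query :: "operation \<Rightarrow> bool" where
  "is_input_query (Input_Query b ctl) = True"
| "is_input_query _ = False"

fun is_advice_query :: "operation \<Rightarrow> bool" where
  "is_advice_query (Advice_Query b ctl) = True"
| "is_advice_query _ = False"

definition cost :: "algorithm \<Rightarrow> nat" where
  "cost alg = length (filter is_input_query (operations alg))"

definition advice_uses :: "algorithm \<Rightarrow> nat" where
  "advice_uses alg = length (filter is_advice_query (operations alg))"

definition orthonormal_basis :: "nat \<Rightarrow> (nat \<Rightarrow> complex vec) \<Rightarrow> bool" where
  "orthonormal_basis N u \<longleftrightarrow>
     (\<forall>j<N. u j \<in> carrier_vec N) \<and>
     (\<forall>j<N. \<forall>k<N. u j \<bullet>c u k = (if j = k then 1 else 0))"

definition unitary_of :: "nat \<Rightarrow> (nat \<Rightarrow> complex vec) \<Rightarrow> (nat \<Rightarrow> real) \<Rightarrow> complex mat" where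
  "unitary_of N u \<theta> = mat N N (\<lambda>(r, c). \<Sum>j<N. cis (\<theta> j) * (u j $ r) * cnj (u j $ c))"

definition theta_max :: "nat \<Rightarrow> (nat \<Rightarrow> real) \<Rightarrow> real" where
  "theta_max N \<theta> = Max (\<theta> ` {..<N})"

definition input_promise :: "nat \<Rightarrow> real \<Rightarrow> (nat \<Rightarrow> complex vec) \<Rightarrow> (nat \<Rightarrow> real) \<Rightarrow> bool" where
  "input_promise N \<delta> u \<theta> \<longleftrightarrow>
     orthonormal_basis N u \<and>
     (\<forall>j<N. \<theta> j \<in> {0..<2 * pi}) \<and>
     theta_max N \<theta> \<in> {0..<2 * pi - 2 * \<delta>}"

definition top_space :: "nat \<Rightarrow> (nat \<Rightarrow> complex vec) \<Rightarrow> (nat \<Rightarrow> real) \<Rightarrow> complex vec set" where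
  "top_space N u \<theta> =
     LinearCombinations.module.span class_ring (module_vec TYPE(complex) N)
       {u j | j. j < N \<and> \<theta> j = theta_max N \<theta>}"

definition orth_proj :: "complex vec set \<Rightarrow> complex vec \<Rightarrow> complex vec" where
  "orth_proj S v = (THE w. w \<in> S \<and> (\<forall>s\<in>S. (v - w) \<bullet>c s = 0))"

definition valid_advice ::
    "nat \<Rightarrow> real \<Rightarrow> (nat \<Rightarrow> complex vec) \<Rightarrow> (nat \<Rightarrow> real) \<Rightarrow> complex mat \<Rightarrow> bool" where
  "valid_advice N \<gamma> u \<theta> A \<longleftrightarrow>
     unitary_mat N A \<and>
     sqnorm (orth_proj (top_space N u \<theta>) (A *\<^sub>v unit_vec N 0)) \<ge> \<gamma>\<^sup>2"

definition correct_outputs :: "real \<Rightarrow> real \<Rightarrow> real set" where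
  "correct_outputs \<delta> \<phi> = {x. \<exists>k::int. \<bar>x + 2 * pi * of_int k - \<phi>\<bar> \<le> \<delta>}"

definition solves_maxQPE ::
    "(nat \<Rightarrow> complex vec) set \<Rightarrow> nat \<Rightarrow> real \<Rightarrow> real \<Rightarrow> nat \<Rightarrow> algorithm \<Rightarrow> bool" where
  "solves_maxQPE \<B> N \<delta> \<gamma> t alg \<longleftrightarrow>
     algorithm_ok N alg \<and> advice_uses alg \<le> t \<and>
     (\<forall>u\<in>\<B>. \<forall>\<theta> A. input_promise N \<delta> u \<theta> \<and> valid_advice N \<gamma> u \<theta> A \<longrightarrow>
        output_prob N (unitary_of N u \<theta>) A alg (correct_outputs \<delta> (theta_max N \<theta>)) \<ge> 2 / 3)"

definition solves_maxQPE_known :: "nat \<Rightarrow> real \<Rightarrow> real \<Rightarrow> nat \<Rightarrow> algorithm \<Rightarrow> bool" where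
  "solves_maxQPE_known N = solves_maxQPE {unit_vec N} N"

definition solves_maxQPE_unknown :: "nat \<Rightarrow> real \<Rightarrow> real \<Rightarrow> nat \<Rightarrow> algorithm \<Rightarrow> bool" where
  "solves_maxQPE_unknown N = solves_maxQPE UNIV N"

end

theory Submission
  imports Defs "HOL-Analysis.L2_Norm"
begin

text \<open>
  Put \<open>K = \<lfloor>1 / \<gamma>\<^sup>2\<rfloor> \<le> N\<close>.  A fixed unitary preparing the uniform superposition of the first
  \<open>K\<close> basis states is valid advice for every diagonal input whose top eigenspace contains one of
  these states, so on such inputs the advice reveals nothing, however often it is used.
  Compare the identity with the inputs having a single nonzero phase \<open>3\<delta>\<close>, at position \<open>x < K\<close>:
  their correct outputs are disjoint.  In a hybrid argument every query changes the state by at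
  most \<open>3\<delta>\<close> times the norm of its component on \<open>|x>\<close>, where the state is that of the run
  on the identity.  By Cauchy-Schwarz, these norms sum to at most \<open>sqrt K\<close> over \<open>x < K\<close>, so
  \<open>T\<close> queries move some final state by at most \<open>3\<delta> T / sqrt K\<close>, whereas correctness
  requires a constant distance.
\<close>

section \<open>Norms and unitary matrices\<close>

abbreviation vnorm :: "complex vec \<Rightarrow> real" where
  "vnorm v \<equiv> sqrt (sqnorm v)"

lemma vnorm_eq_L2_set: "vnorm v = L2_set (\<lambda>i. cmod (v $ i)) {..<dim_vec v}"
  by (simp add: L2_set_def sqnorm_def)

lemma vnorm_triangle:
  assumes "v \<in> carrier_vec n" "w \<in> carrier_vec n"
  shows "vnorm (v + w) \<le> vnorm v + vnorm w"
proof -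
  have "vnorm (v + w) \<le> L2_set (\<lambda>i. cmod (v $ i) + cmod (w $ i)) {..<n}"
    using assms by (auto simp: vnorm_eq_L2_set intro!: L2_set_mono norm_triangle_ineq)
  also have "\<dots> \<le> L2_set (\<lambda>i. cmod (v $ i)) {..<n} + L2_set (\<lambda>i. cmod (w $ i)) {..<n}"
    by (rule L2_set_triangle_ineq)
  finally show ?thesis
    using assms by (simp add: vnorm_eq_L2_set)
qed

lemma sqnorm_eq_cscalar_prod: "complex_of_real (sqnorm v) = v \<bullet>c v"
  by (simp add: sqnorm_def scalar_prod_def lessThan_atLeast0 complex_norm_square[symmetric])

lemma mat_adjoint_carrier:
  "A \<in> carrier_mat n m \<Longrightarrow> (mat_adjoint A :: complex mat) \<in> carrier_mat m n"
  by (auto simp: mat_adjoint_def)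

lemma mat_adjoint_index:
  assumes "A \<in> carrier_mat n m" "i < m" "j < n"
  shows "mat_adjoint A $$ (i, j) = cnj (A $$ (j, i))"
  using assms by (simp add: mat_adjoint_def mat_of_rows_index)

lemma mat_adjoint_mat_adjoint:
  assumes "A \<in> carrier_mat n m"
  shows "mat_adjoint (mat_adjoint A) = (A :: complex mat)"
  using assms mat_adjoint_carrier[OF assms] mat_adjoint_carrier[OF mat_adjoint_carrier[OF assms]]
  by (intro eq_matI) (auto simp: mat_adjoint_index[where n = m and m = n]
      mat_adjoint_index[where n = n and m = m])

lemma cscalar_prod_mat_adjoint:
  fixes A :: "complex mat"
  assumes "A \<in> carrier_mat n n" "v \<in> carrier_vec n" "w \<in> carrier_vec n"
  shows "(A *\<^sub>v v) \<bullet>c w = v \<bullet>c (mat_adjoint A *\<^sub>v w)"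
proof -
  have adj: "mat_adjoint A \<in> carrier_mat n n"
    using assms(1) by (rule mat_adjoint_carrier)
  have "(A *\<^sub>v v) \<bullet>c w = (\<Sum>i<n. \<Sum>j<n. A $$ (i, j) * v $ j * cnj (w $ i))"
    using assms by (simp add: scalar_prod_def lessThan_atLeast0 sum_distrib_right)
  also have "\<dots> = (\<Sum>j<n. \<Sum>i<n. A $$ (i, j) * v $ j * cnj (w $ i))"
    by (rule sum.swap)
  also have "\<dots> = v \<bullet>c (mat_adjoint A *\<^sub>v w)"
    using assms adj
    by (simp add: scalar_prod_def lessThan_atLeast0 sum_distrib_left mat_adjoint_index ac_simps)
  finally show ?thesis .
qed

lemma unitary_mat_adjoint: "unitary_mat n V \<Longrightarrow> unitary_mat n (mat_adjoint V)"
  using mat_adjoint_mat_adjoint[of V n n] mat_adjoint_carrier[of V n n]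
  by (auto simp: unitary_mat_def)

lemma unitary_mat_sqnorm:
  assumes "unitary_mat n V" "v \<in> carrier_vec n"
  shows "sqnorm (V *\<^sub>v v) = sqnorm v"
proof -
  have V: "V \<in> carrier_mat n n" and VV: "mat_adjoint V * V = 1\<^sub>m n"
    using assms by (auto simp: unitary_mat_def)
  have "complex_of_real (sqnorm (V *\<^sub>v v)) = v \<bullet>c (mat_adjoint V *\<^sub>v (V *\<^sub>v v))"
    unfolding sqnorm_eq_cscalar_prod using V assms(2) by (subst cscalar_prod_mat_adjoint) auto
  also have "mat_adjoint V *\<^sub>v (V *\<^sub>v v) = v"
    using V mat_adjoint_carrier[OF V] assms(2) VV
    by (subst assoc_mult_mat_vec[symmetric]) auto
  finally show ?thesis
    by (simp add: sqnorm_eq_cscalar_prod[symmetric])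
qed


section \<open>Oracle operations\<close>

lemma sum_block:
  "sum f {x * m..<x * m + m} = (\<Sum>w<m. f (x * m + w))" for m :: nat
  using sum.shift_bounds_nat_ivl[of f 0 "x * m" m]
  by (simp add: lessThan_atLeast0 add.commute)

text \<open>The joint index set consists of N consecutive blocks of length m, one for each basis
  state of the register.\<close>

lemma sum_blocks:
  "sum f {..<N * m} = (\<Sum>x<N. \<Sum>w<m. f (x * m + w))" for m :: nat
  by (simp add: sum.nat_group[symmetric] sum_block)

definition slice :: "nat \<Rightarrow> nat \<Rightarrow> nat \<Rightarrow> complex vec \<Rightarrow> complex vec" where
  "slice N m w v = vec N (\<lambda>x. v $ (x * m + w))"

lemma block_index_less: "x * m + w < N * m" if "x < N" "w < m" for x w m N :: nat
proof -
  have "x * m + w < Suc x * m"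
    using that by simp
  also have "\<dots> \<le> N * m"
    using that by (intro mult_right_mono) auto
  finally show ?thesis .
qed

lemma sqnorm_slices:
  assumes "v \<in> carrier_vec (N * m)"
  shows "sqnorm v = (\<Sum>w<m. sqnorm (slice N m w v))"
  using assms by (simp add: sqnorm_def slice_def sum_blocks sum.swap[of _ "{..<m}"])

lemma on_register_carrier: "on_register N m ctl V \<in> carrier_mat (N * m) (N * m)"
  by (simp add: on_register_def)

lemma slice_on_register:
  assumes V: "V \<in> carrier_mat N N" and v: "v \<in> carrier_vec (N * m)" and w: "w < m"
  shows "slice N m w (on_register N m ctl V *\<^sub>v v) =
    (if control_active ctl w then V *\<^sub>v slice N m w v else slice N m w v)"
proof (rule eq_vecI)
  fix x assume "x < dim_vec (if control_active ctl w then V *\<^sub>v slice N m w v else slice N m w v)"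
  then have x: "x < N"
    using V by (auto simp: slice_def split: if_splits)
  have i: "x * m + w < N * m"
    using x w by (rule block_index_less)
  have "slice N m w (on_register N m ctl V *\<^sub>v v) $ x =
      (\<Sum>j<N * m. on_register N m ctl V $$ (x * m + w, j) * v $ j)"
    using x i v by (simp add: slice_def on_register_def scalar_prod_def lessThan_atLeast0)
  also have "\<dots> = (\<Sum>y<N. \<Sum>w'<m. if w' = w then
      (if control_active ctl w then V $$ (x, y) else if x = y then 1 else 0) * v $ (y * m + w) else 0)"
    unfolding sum_blocks
  proof (intro sum.cong refl)
    fix y w' assume "y \<in> {..<N}" "w' \<in> {..<m}"
    moreover from this have "y * m + w' < N * m"
      by (auto intro: block_index_less)
    ultimately show "on_register N m ctl V $$ (x * m + w, y * m + w') * v $ (y * m + w') =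
      (if w' = w then (if control_active ctl w then V $$ (x, y) else if x = y then 1 else 0) *
        v $ (y * m + w) else 0)"
      using i w by (auto simp: on_register_def)
  qed
  also have "\<dots> = (\<Sum>y<N. (if control_active ctl w then V $$ (x, y) else if x = y then 1 else 0) *
      v $ (y * m + w))"
    using w by (simp add: sum.delta)
  also have "\<dots> = (if control_active ctl w then V *\<^sub>v slice N m w v else slice N m w v) $ x"
    using x V by (auto simp: slice_def scalar_prod_def lessThan_atLeast0 if_distrib[of "\<lambda>a. a * _"]
        cong: if_cong)
  finally show "slice N m w (on_register N m ctl V *\<^sub>v v) $ x =
    (if control_active ctl w then V *\<^sub>v slice N m w v else slice N m w v) $ x" .
qed (use V in \<open>auto simp: slice_def\<close>)

lemma sqnorm_on_register:
  assumes "unitary_mat N V" "v \<in> carrier_vec (N * m)"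
  shows "sqnorm (on_register N m ctl V *\<^sub>v v) = sqnorm v"
proof -
  have V: "V \<in> carrier_mat N N"
    using assms by (simp add: unitary_mat_def)
  have "sqnorm (slice N m w (on_register N m ctl V *\<^sub>v v)) = sqnorm (slice N m w v)"
    if "w < m" for w
    using slice_on_register[OF V assms(2) that, of ctl] unitary_mat_sqnorm[OF assms(1)]
    by (auto simp: slice_def)
  then show ?thesis
    using assms(2) on_register_carrier[of N m ctl V] by (simp add: sqnorm_slices[of _ N m])
qed

lemma operation_mat_carrier:
  "operation_ok N m p \<Longrightarrow> operation_mat N m U A p \<in> carrier_mat (N * m) (N * m)"
  by (cases p) (auto simp: unitary_mat_def on_register_carrier)

lemma sqnorm_operation_mat:
  assumes "operation_ok N m p" "unitary_mat N U" "unitary_mat N A" "v \<in> carrier_vec (N * m)"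
  shows "sqnorm (operation_mat N m U A p *\<^sub>v v) = sqnorm v"
  using assms
  by (cases p) (auto simp: unitary_mat_sqnorm sqnorm_on_register unitary_mat_adjoint)

text \<open>\<open>final_state\<close> with a free operation list and start vector, as inductions
  over the list require.\<close>

abbreviation run ::
    "nat \<Rightarrow> nat \<Rightarrow> complex mat \<Rightarrow> complex mat \<Rightarrow> operation list \<Rightarrow> complex vec \<Rightarrow> complex vec" where
  "run N m U A ops v \<equiv> foldl (\<lambda>\<psi> p. operation_mat N m U A p *\<^sub>v \<psi>) v ops"

lemma run_carrier:
  assumes "\<forall>p\<in>set ops. operation_ok N m p" "v \<in> carrier_vec (N * m)"
  shows "run N m U A ops v \<in> carrier_vec (N * m)"
  using assms
  by (induction ops arbitrary: v) (auto intro!: mult_mat_vec_carrier[OF operation_mat_carrier])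

lemma sqnorm_run:
  assumes "\<forall>p\<in>set ops. operation_ok N m p" "unitary_mat N U" "unitary_mat N A"
    "v \<in> carrier_vec (N * m)"
  shows "sqnorm (run N m U A ops v) = sqnorm v"
  using assms(1,4)
proof (induction ops arbitrary: v)
  case (Cons p ops)
  then have p: "operation_ok N m p"
    by simp
  show ?case
    using Cons sqnorm_operation_mat[OF p assms(2,3)]
      mult_mat_vec_carrier[OF operation_mat_carrier[OF p]]
    by simp
qed simp


section \<open>Diagonal inputs\<close>

abbreviation diag_unitary :: "nat \<Rightarrow> (nat \<Rightarrow> real) \<Rightarrow> complex mat" where
  "diag_unitary N \<theta> \<equiv> unitary_of N (unit_vec N) \<theta>"

lemma diag_unitary_eq:
  "diag_unitary N \<theta> = mat N N (\<lambda>(r, c). if r = c then cis (\<theta> r) else 0)"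
proof (rule eq_matI)
  fix i j assume "i < dim_row (mat N N (\<lambda>(r, c). if r = c then cis (\<theta> r) else 0))"
    "j < dim_col (mat N N (\<lambda>(r, c). if r = c then cis (\<theta> r) else 0))"
  then have ij: "i < N" "j < N"
    by simp_all
  have "diag_unitary N \<theta> $$ (i, j) =
      (\<Sum>k<N. if k = i then (if i = j then cis (\<theta> i) else 0) else 0)"
  proof -
    have "diag_unitary N \<theta> $$ (i, j) =
        (\<Sum>k<N. cis (\<theta> k) * unit_vec N k $ i * cnj (unit_vec N k $ j))"
      using ij by (simp add: unitary_of_def)
    also have "\<dots> = (\<Sum>k<N. if k = i then (if i = j then cis (\<theta> i) else 0) else 0)"
      using ij by (intro sum.cong refl) auto
    finally show ?thesis .
  qed
  then show "diag_unitary N \<theta> $$ (i, j) =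
      mat N N (\<lambda>(r, c). if r = c then cis (\<theta> r) else 0) $$ (i, j)"
    using ij by simp
qed (auto simp: unitary_of_def)

lemma mat_adjoint_diag_unitary:
  "mat_adjoint (diag_unitary N \<theta>) = diag_unitary N (\<lambda>j. - \<theta> j)"
proof -
  have "diag_unitary N \<theta> \<in> carrier_mat N N"
    by (simp add: diag_unitary_eq)
  from mat_adjoint_carrier[OF this] mat_adjoint_index[OF this] show ?thesis
    by (intro eq_matI) (auto simp: diag_unitary_eq cis_cnj)
qed

lemma diag_unitary_mult:
  "diag_unitary N \<theta> * diag_unitary N \<phi> = diag_unitary N (\<lambda>j. \<theta> j + \<phi> j)"
proof (rule eq_matI)
  fix i j assume "i < dim_row (diag_unitary N (\<lambda>j. \<theta> j + \<phi> j))"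
    "j < dim_col (diag_unitary N (\<lambda>j. \<theta> j + \<phi> j))"
  then have ij: "i < N" "j < N"
    by (simp_all add: unitary_of_def)
  have "(diag_unitary N \<theta> * diag_unitary N \<phi>) $$ (i, j) =
      (\<Sum>k<N. (if i = k then cis (\<theta> i) else 0) * (if k = j then cis (\<phi> k) else 0))"
    using ij by (simp add: diag_unitary_eq scalar_prod_def lessThan_atLeast0)
  also have "\<dots> = (\<Sum>k<N. if k = i then (if i = j then cis (\<theta> i) * cis (\<phi> i) else 0) else 0)"
    by (intro sum.cong refl) auto
  finally show "(diag_unitary N \<theta> * diag_unitary N \<phi>) $$ (i, j) =
      diag_unitary N (\<lambda>j. \<theta> j + \<phi> j) $$ (i, j)"
    using ij by (simp add: diag_unitary_eq cis_mult)
qed (auto simp: diag_unitary_eq)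

text \<open>Adjoints negate the phases, products add them, and zero phases give the identity
  matrix.\<close>

lemma unitary_diag_unitary: "unitary_mat N (diag_unitary N \<theta>)"
proof -
  have "diag_unitary N (\<lambda>j. 0) = 1\<^sub>m N"
    by (intro eq_matI) (auto simp: diag_unitary_eq)
  moreover have "diag_unitary N \<theta> \<in> carrier_mat N N"
    by (simp add: diag_unitary_eq)
  ultimately show ?thesis
    by (simp add: unitary_mat_def mat_adjoint_diag_unitary diag_unitary_mult)
qed

lemma on_register_diag_unitary:
  assumes "v \<in> carrier_vec (N * m)" "i < N * m"
  shows "(on_register N m ctl (diag_unitary N \<theta>) *\<^sub>v v) $ i =
    (if control_active ctl (i mod m) then cis (\<theta> (i div m)) else 1) * v $ i"
proof -
  have div_less: "k div m < N" if "k < N * m" for k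
    using that by (simp add: less_mult_imp_div_less)
  have "on_register N m ctl (diag_unitary N \<theta>) $$ (i, j) =
      (if j = i then (if control_active ctl (i mod m) then cis (\<theta> (i div m)) else 1) else 0)"
    if "j < N * m" for j
  proof (cases "j = i")
    case False
    then have "i mod m \<noteq> j mod m \<or> i div m \<noteq> j div m"
      by (metis div_mult_mod_eq)
    with False that assms(2) div_less show ?thesis
      by (auto simp: on_register_def diag_unitary_eq)
  qed (use assms(2) div_less in \<open>auto simp: on_register_def diag_unitary_eq\<close>)
  moreover have "(on_register N m ctl (diag_unitary N \<theta>) *\<^sub>v v) $ i =
      (\<Sum>j<N * m. on_register N m ctl (diag_unitary N \<theta>) $$ (i, j) * v $ j)"
    using assms on_register_carrier[of N m ctl "diag_unitary N \<theta>"]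
    by (simp add: scalar_prod_def lessThan_atLeast0)
  moreover have "(\<Sum>j<N * m. (if j = i then a else 0) * v $ j) = a * v $ i" for a :: complex
  proof -
    have "(\<Sum>j<N * m. (if j = i then a else 0) * v $ j) = (\<Sum>j<N * m. if j = i then a * v $ i else 0)"
      by (intro sum.cong refl) auto
    then show ?thesis
      using assms(2) by simp
  qed
  ultimately show ?thesis
    by simp
qed

text \<open>The chord from 1 to \<open>cis t\<close> has length 2 |sin(t/2)|, at most the length |t|
  of the arc.\<close>

lemma cmod_cis_diff_one_le: "cmod (cis t - 1) \<le> \<bar>t\<bar>"
proof -
  have "(cmod (cis t - 1))\<^sup>2 = (2 * \<bar>sin (t / 2)\<bar>)\<^sup>2"
    using cos_double_sin[of "t / 2"] sin_cos_squared_add[of t]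
    unfolding cmod_power2 by (simp add: power_mult_distrib power2_diff)
  then have "cmod (cis t - 1) = 2 * \<bar>sin (t / 2)\<bar>"
    by (simp only: power2_eq_iff_nonneg norm_ge_zero)
  then show ?thesis
    using abs_sin_x_le_abs_x[of "t / 2"] by simp
qed


section \<open>The hybrid argument\<close>

definition block_norm :: "nat \<Rightarrow> nat \<Rightarrow> complex vec \<Rightarrow> real" where
  "block_norm m x v = L2_set (\<lambda>i. cmod (v $ i)) {x * m..<x * m + m}"

text \<open>Cauchy-Schwarz against the all-ones vector of length K; the squared block norms sum to
  at most \<open>sqnorm v\<close> because the blocks partition the index set.\<close>

lemma sum_block_norm_le:
  assumes v: "v \<in> carrier_vec (N * m)" and K: "K \<le> N"
  shows "(\<Sum>x<K. block_norm m x v) \<le> sqrt K * vnorm v"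
proof -
  have "(\<Sum>x<K. (block_norm m x v)\<^sup>2) \<le> (\<Sum>x<N. (block_norm m x v)\<^sup>2)"
    using K by (intro sum_mono2) auto
  also have "\<dots> = sqnorm v"
    using v by (simp add: block_norm_def L2_set_def sum_nonneg sum.nat_group sqnorm_def)
  finally have "L2_set (\<lambda>x. block_norm m x v) {..<K} \<le> vnorm v"
    by (simp add: L2_set_def)
  moreover have "(\<Sum>x<K. \<bar>block_norm m x v\<bar> * \<bar>1\<bar>) \<le>
      L2_set (\<lambda>x. block_norm m x v) {..<K} * L2_set (\<lambda>x. 1) {..<K}"
    by (rule L2_set_mult_ineq)
  moreover have "0 \<le> block_norm m x v" for x
    by (simp add: block_norm_def)
  ultimately have "(\<Sum>x<K. block_norm m x v) \<le> L2_set (\<lambda>x. block_norm m x v) {..<K} * sqrt K"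
    by (simp add: L2_set_constant)
  also have "\<dots> \<le> vnorm v * sqrt K"
    using \<open>L2_set _ _ \<le> vnorm v\<close> by (rule mult_right_mono) simp
  finally show ?thesis
    by (simp add: mult.commute)
qed

text \<open>Outside block \<open>x\<close> both queries act as the identity. Inside it, each
  amplitude is multiplied by 1 or by a phase at distance at most
  \<open>\<bar>\<theta> x\<bar>\<close> from 1.\<close>

lemma query_perturbation:
  assumes v: "v \<in> carrier_vec (N * m)" and x: "x < N"
    and \<theta>: "\<And>j. j \<noteq> x \<Longrightarrow> \<theta> j = 0"
  shows "vnorm (on_register N m ctl (diag_unitary N \<theta>) *\<^sub>v v -
      on_register N m ctl (diag_unitary N (\<lambda>_. 0)) *\<^sub>v v) \<le> \<bar>\<theta> x\<bar> * block_norm m x v"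
    (is "vnorm ?d \<le> _")
proof -
  have d: "?d \<in> carrier_vec (N * m)"
    using v on_register_carrier by (intro minus_carrier_vec mult_mat_vec_carrier) auto
  have d_index: "?d $ i = ((if control_active ctl (i mod m) then cis (\<theta> (i div m)) else 1) - 1) * v $ i"
    if "i < N * m" for i
  proof -
    have "dim_vec (on_register N m ctl V *\<^sub>v v) = N * m" for V
      by (simp add: on_register_def)
    then show ?thesis
      using that v
      by (simp add: on_register_diag_unitary algebra_simps del: index_mult_mat_vec dim_mult_mat_vec)
  qed
  have subset: "{x * m..<x * m + m} \<subseteq> {..<N * m}"
  proof -
    have "Suc x * m \<le> N * m"
      using x by (intro mult_right_mono) auto
    then show ?thesis
      by auto
  qed
  have "sqnorm ?d = (\<Sum>i<N * m. (cmod (?d $ i))\<^sup>2)"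
    by (simp only: sqnorm_def carrier_vecD[OF d])
  also have "\<dots> = (\<Sum>i\<in>{x * m..<x * m + m}. (cmod (?d $ i))\<^sup>2)"
  proof (rule sum.mono_neutral_right)
    show "\<forall>i\<in>{..<N * m} - {x * m..<x * m + m}. (cmod (?d $ i))\<^sup>2 = 0"
    proof
      fix i assume i: "i \<in> {..<N * m} - {x * m..<x * m + m}"
      then have outside: "i < x * m \<or> x * m + m \<le> i" and "0 < m"
        by (auto intro: ccontr)
      have "i div m \<noteq> x"
      proof
        assume "i div m = x"
        then have "x * m + i mod m = i"
          using div_mult_mod_eq[of i m] by simp
        with outside mod_less_divisor[OF \<open>0 < m\<close>, of i] show False
          by linarith
      qed
      with i \<theta> show "(cmod (?d $ i))\<^sup>2 = 0"
        by (simp add: d_index)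
    qed
  qed (use subset in auto)
  finally have "vnorm ?d = L2_set (\<lambda>i. cmod (?d $ i)) {x * m..<x * m + m}"
    unfolding L2_set_def by (rule arg_cong)
  also have "\<dots> \<le> L2_set (\<lambda>i. \<bar>\<theta> x\<bar> * cmod (v $ i)) {x * m..<x * m + m}"
  proof (rule L2_set_mono)
    fix i assume i: "i \<in> {x * m..<x * m + m}"
    then have "i div m = x"
      by (auto intro!: div_nat_eqI simp: mult.commute)
    moreover have "i < N * m"
      using i subset by auto
    ultimately show "cmod (?d $ i) \<le> \<bar>\<theta> x\<bar> * cmod (v $ i)"
      by (auto simp: d_index norm_mult intro!: mult_right_mono cmod_cis_diff_one_le)
  qed simp
  also have "\<dots> = \<bar>\<theta> x\<bar> * block_norm m x v"
    by (simp add: block_norm_def L2_set_right_distrib)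
  finally show ?thesis .
qed

text \<open>The total query magnitude of a hybrid argument: how strongly the run with
  \<open>U\<close> queries position \<open>x\<close>, measured just before each input query. Norms
  are not squared because the triangle inequality adds them.\<close>

primrec query_mass ::
    "nat \<Rightarrow> nat \<Rightarrow> complex mat \<Rightarrow> complex mat \<Rightarrow> nat \<Rightarrow> operation list \<Rightarrow> complex vec \<Rightarrow> real" where
  "query_mass N m U A x [] v = 0"
| "query_mass N m U A x (p # ops) v =
     (if is_input_query p then block_norm m x v else 0) +
     query_mass N m U A x ops (operation_mat N m U A p *\<^sub>v v)"

text \<open>All operations preserve the norm, so \<open>sum_block_norm_le\<close> gives the same
  bound for each input query.\<close>

lemma sum_query_mass_le:
  assumes "\<forall>p\<in>set ops. operation_ok N m p" "unitary_mat N U" "unitary_mat N A"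
    "v \<in> carrier_vec (N * m)" "K \<le> N"
  shows "(\<Sum>x<K. query_mass N m U A x ops v) \<le>
    length (filter is_input_query ops) * sqrt K * vnorm v"
  using assms(1,4)
proof (induction ops arbitrary: v)
  case (Cons p ops)
  let ?v = "operation_mat N m U A p *\<^sub>v v"
  have ok: "operation_ok N m p"
    using Cons.prems by simp
  have "?v \<in> carrier_vec (N * m)"
    using operation_mat_carrier[OF ok] Cons.prems by (auto intro: mult_mat_vec_carrier)
  with Cons have "(\<Sum>x<K. query_mass N m U A x ops ?v) \<le>
      length (filter is_input_query ops) * sqrt K * vnorm ?v"
    by simp
  also have "vnorm ?v = vnorm v"
    using sqnorm_operation_mat[OF ok assms(2,3)] Cons.prems by simp
  finally show ?case
    using sum_block_norm_le[OF Cons.prems(2) assms(5)]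
    by (auto simp: sum.distrib algebra_simps)
qed simp

text \<open>Two start vectors are allowed because the runs drift apart after the first query. Only
  the query mass of the reference run, started at \<open>w\<close>, enters the bound.\<close>

lemma run_perturbation:
  assumes "\<forall>p\<in>set ops. operation_ok N m p" "unitary_mat N A"
    "v \<in> carrier_vec (N * m)" "w \<in> carrier_vec (N * m)"
    and x: "x < N" and \<theta>: "\<And>j. j \<noteq> x \<Longrightarrow> \<theta> j = 0"
  shows "vnorm (run N m (diag_unitary N \<theta>) A ops v - run N m (diag_unitary N (\<lambda>_. 0)) A ops w)
    \<le> vnorm (v - w) + \<bar>\<theta> x\<bar> * query_mass N m (diag_unitary N (\<lambda>_. 0)) A x ops w"
  using assms(1,3,4)
proof (induction ops arbitrary: v w)
  case (Cons p ops)
  define P where "P = operation_mat N m (diag_unitary N \<theta>) A p"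
  define Q where "Q = operation_mat N m (diag_unitary N (\<lambda>_. 0)) A p"
  have ok: "operation_ok N m p"
    using Cons.prems by simp
  have P: "P \<in> carrier_mat (N * m) (N * m)" and Q: "Q \<in> carrier_mat (N * m) (N * m)"
    unfolding P_def Q_def using operation_mat_carrier[OF ok] by auto
  note vw = Cons.prems(2,3)
  have carrier: "P *\<^sub>v v \<in> carrier_vec (N * m)" "P *\<^sub>v w \<in> carrier_vec (N * m)"
    "Q *\<^sub>v w \<in> carrier_vec (N * m)"
    using P Q vw by (auto intro: mult_mat_vec_carrier)
  \<comment> \<open>The hybrid step: \<open>P\<close> carries the old error along without enlarging
    it, and the new error is measured at the reference state \<open>w\<close>.\<close>
  have "P *\<^sub>v v - Q *\<^sub>v w = P *\<^sub>v (v - w) + (P *\<^sub>v w - Q *\<^sub>v w)"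
    using P Q vw carrier by (auto simp: mult_minus_distrib_mat_vec)
  then have "vnorm (P *\<^sub>v v - Q *\<^sub>v w) \<le> vnorm (P *\<^sub>v (v - w)) + vnorm (P *\<^sub>v w - Q *\<^sub>v w)"
    using vnorm_triangle[of "P *\<^sub>v (v - w)" "N * m" "P *\<^sub>v w - Q *\<^sub>v w"] P vw carrier
    by (auto intro: mult_mat_vec_carrier)
  also have "vnorm (P *\<^sub>v (v - w)) = vnorm (v - w)"
    unfolding P_def using sqnorm_operation_mat[OF ok unitary_diag_unitary assms(2)] vw by simp
  also have "vnorm (P *\<^sub>v w - Q *\<^sub>v w) \<le> \<bar>\<theta> x\<bar> * (if is_input_query p then block_norm m x w else 0)"
  proof (cases p)
    case (Input_Query b ctl)
    \<comment> \<open>An inverse query is a query with negated phases, which has the same bound and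
      leaves the reference input fixed.\<close>
    show ?thesis
      using query_perturbation[OF vw(2) x \<theta>, where ctl = ctl]
        query_perturbation[OF vw(2) x, where \<theta> = "\<lambda>j. - \<theta> j" and ctl = ctl] \<theta>
      unfolding P_def Q_def Input_Query by (cases b) (simp_all add: mat_adjoint_diag_unitary)
  next
    case Free
    then show ?thesis
      using carrier by (simp add: P_def Q_def sqnorm_def)
  next
    case Advice_Query
    then show ?thesis
      using carrier by (simp add: P_def Q_def sqnorm_def)
  qed
  finally have "vnorm (P *\<^sub>v v - Q *\<^sub>v w) \<le>
      vnorm (v - w) + \<bar>\<theta> x\<bar> * (if is_input_query p then block_norm m x w else 0)"
    by simp
  moreover have "vnorm (run N m (diag_unitary N \<theta>) A ops (P *\<^sub>v v) -
        run N m (diag_unitary N (\<lambda>_. 0)) A ops (Q *\<^sub>v w))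
      \<le> vnorm (P *\<^sub>v v - Q *\<^sub>v w) +
        \<bar>\<theta> x\<bar> * query_mass N m (diag_unitary N (\<lambda>_. 0)) A x ops (Q *\<^sub>v w)"
    using Cons.IH[OF _ carrier(1,3)] Cons.prems(1) by simp
  ultimately show ?case
    by (simp add: P_def[symmetric] Q_def[symmetric] distrib_left)
qed simp


section \<open>Measurements\<close>

text \<open>Unlike \<open>output_prob\<close>, this takes an arbitrary vector, so it can be
  evaluated at the difference of two states.\<close>

definition outcome_weight :: "(complex mat \<times> real) list \<Rightarrow> real set \<Rightarrow> complex vec \<Rightarrow> real" where
  "outcome_weight M X v = (\<Sum>(E, x)\<leftarrow>M. if x \<in> X then Re ((E *\<^sub>v v) \<bullet>c v) else 0)"

lemma outcome_weight_Nil [simp]: "outcome_weight [] X v = 0"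
  by (simp add: outcome_weight_def)

lemma outcome_weight_Cons [simp]: "outcome_weight (a # M) X v =
    (if snd a \<in> X then Re ((fst a *\<^sub>v v) \<bullet>c v) else 0) + outcome_weight M X v"
  by (simp add: outcome_weight_def split_beta)

lemma outcome_weight_empty [simp]: "outcome_weight M {} v = 0"
  by (induction M) simp_all

text \<open>A weighted Cauchy-Schwarz estimate. The factor 3/2 turns a probability of 1/3 into only
  1/2, which stays below the required 2/3.\<close>

lemma psd_mat_mixed_le:
  assumes E: "psd_mat n E" and v: "v \<in> carrier_vec n" and w: "w \<in> carrier_vec n"
  shows "Re ((E *\<^sub>v (v + w)) \<bullet>c (v + w)) \<le>
    3 / 2 * Re ((E *\<^sub>v v) \<bullet>c v) + 3 * Re ((E *\<^sub>v w) \<bullet>c w)"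
proof -
  have carrier: "E \<in> carrier_mat n n"
    using E by (simp add: psd_mat_def)
  have Ev: "E *\<^sub>v v \<in> carrier_vec n" and Ew: "E *\<^sub>v w \<in> carrier_vec n"
    using carrier v w by (auto intro: mult_mat_vec_carrier)
  let ?q = "\<lambda>a b. (E *\<^sub>v a) \<bullet>c b"
  have expand: "?q (v + c \<cdot>\<^sub>v w) (v + c \<cdot>\<^sub>v w) =
      ?q v v + cnj c * ?q v w + c * ?q w v + c * cnj c * ?q w w" for c
  proof -
    have "?q (v + c \<cdot>\<^sub>v w) (v + c \<cdot>\<^sub>v w) =
        (E *\<^sub>v v + c \<cdot>\<^sub>v (E *\<^sub>v w)) \<bullet> (conjugate v + cnj c \<cdot>\<^sub>v conjugate w)"
      using carrier v w
      by (simp add: mult_add_distrib_mat_vec mult_mat_vec conjugate_add_vec[of _ n] conjugate_smult_vec)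
    then show ?thesis
      using v w Ev Ew carrier
      by (simp add: scalar_prod_add_distrib[of _ n] add_scalar_prod_distrib[of _ n] algebra_simps)
  qed
  \<comment> \<open>Positivity at v - 2w bounds the cross terms by half the form at \<open>v\<close>
    plus twice the form at \<open>w\<close>; this choice produces the constants 3/2 and 3.\<close>
  have "0 \<le> Re (?q (v + (-2) \<cdot>\<^sub>v w) (v + (-2) \<cdot>\<^sub>v w))"
    using E v w by (simp add: psd_mat_def)
  then have "0 \<le> Re (?q v v) - 2 * Re (?q v w) - 2 * Re (?q w v) + 4 * Re (?q w w)"
    unfolding expand by simp
  moreover have "Re (?q (v + w) (v + w)) = Re (?q v v) + Re (?q v w) + Re (?q w v) + Re (?q w w)"
    using expand[of 1] by simp
  ultimately show ?thesis
    by simp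
qed

lemma outcome_weight_mixed_le:
  assumes "\<forall>E\<in>set (map fst M). psd_mat n E" "v \<in> carrier_vec n" "w \<in> carrier_vec n"
  shows "outcome_weight M X (v + w) \<le> 3 / 2 * outcome_weight M X v + 3 * outcome_weight M X w"
  using assms(1)
proof (induction M)
  case (Cons a M)
  then show ?case
    using psd_mat_mixed_le[OF _ assms(2,3), of "fst a"] by (auto simp: algebra_simps)
qed simp

text \<open>Every outcome has nonnegative weight and is counted for at most one of the two
  sets.\<close>

lemma outcome_weight_disjoint:
  assumes "\<forall>E\<in>set (map fst M). psd_mat n E" "v \<in> carrier_vec n" "X \<inter> Y = {}"
  shows "outcome_weight M X v + outcome_weight M Y v \<le> outcome_weight M UNIV v"
  using assms(1)
proof (induction M)
  case (Cons a M)
  moreover have "0 \<le> Re ((fst a *\<^sub>v v) \<bullet>c v)"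
    using Cons.prems assms(2) by (simp add: psd_mat_def)
  ultimately show ?case
    using assms(3) by auto
qed simp

lemma outcome_weight_le_UNIV:
  assumes "\<forall>E\<in>set (map fst M). psd_mat n E" "v \<in> carrier_vec n"
  shows "outcome_weight M X v \<le> outcome_weight M UNIV v"
  using outcome_weight_disjoint[OF assms, of X "{}"] by simp

lemma outcome_weight_UNIV:
  assumes "is_povm n (map fst M)" "v \<in> carrier_vec n"
  shows "outcome_weight M UNIV v = sqnorm v"
proof -
  \<comment> \<open>The induction runs over arbitrary lists of positive semidefinite matrices, since
    the tail of a POVM need not sum to the identity.\<close>
  have "foldr (+) (map fst M) (0\<^sub>m n n) \<in> carrier_mat n n \<and>
    Re ((foldr (+) (map fst M) (0\<^sub>m n n) *\<^sub>v v) \<bullet>c v) = outcome_weight M UNIV v"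
    if "\<forall>E\<in>set (map fst M). psd_mat n E" for M :: "(complex mat \<times> real) list"
    using that
  proof (induction M)
    case Nil
    have "0\<^sub>m n n *\<^sub>v v = 0\<^sub>v n"
      using assms(2) by (intro eq_vecI) auto
    then show ?case
      using assms(2) by simp
  next
    case (Cons a M)
    then have "fst a \<in> carrier_mat n n"
      by (simp add: psd_mat_def)
    with Cons assms(2) show ?case
      by (auto simp: add_mult_distrib_mat_vec[of _ n n]
          intro!: add_scalar_prod_distrib[THEN arg_cong[of _ _ Re], THEN trans]
            mult_mat_vec_carrier)
  qed
  from this[of M] have "outcome_weight M UNIV v = Re (v \<bullet>c v)"
    using assms by (simp add: is_povm_def)
  then show ?thesis
    by (simp add: sqnorm_eq_cscalar_prod[symmetric])
qed

text \<open>On \<open>w\<close> the set \<open>X\<close> has probability at most 1/3, so 2/3 <=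
  (3/2)(1/3) + 3 \<open>sqnorm (v - w)\<close>; this is where 1/18 comes from.\<close>

lemma povm_distinguishes:
  assumes povm: "is_povm n (map fst M)" and v: "v \<in> carrier_vec n" and w: "w \<in> carrier_vec n"
    and w1: "sqnorm w = 1" and disjoint: "X \<inter> Y = {}"
    and X: "2 / 3 \<le> outcome_weight M X v" and Y: "2 / 3 \<le> outcome_weight M Y w"
  shows "1 / 18 \<le> sqnorm (v - w)"
proof -
  have psd: "\<forall>E\<in>set (map fst M). psd_mat n E"
    using povm by (simp add: is_povm_def)
  have vw: "v - w \<in> carrier_vec n"
    using v w by simp
  have "w + (v - w) = v"
    using v w by auto
  then have "outcome_weight M X v \<le> 3 / 2 * outcome_weight M X w + 3 * outcome_weight M X (v - w)"
    using outcome_weight_mixed_le[OF psd w vw, of X] by simp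
  moreover have "outcome_weight M X w \<le> 1 / 3"
    using outcome_weight_disjoint[OF psd w disjoint] outcome_weight_UNIV[OF povm w] w1 Y by simp
  moreover have "outcome_weight M X (v - w) \<le> sqnorm (v - w)"
    using outcome_weight_le_UNIV[OF psd vw] outcome_weight_UNIV[OF povm vw] by simp
  ultimately show ?thesis
    using X by simp
qed


section \<open>Hard instances\<close>

lemma orth_proj_eqI:
  fixes S :: "complex vec set"
  assumes w: "w \<in> S" and orth: "\<And>s. s \<in> S \<Longrightarrow> (v - w) \<bullet>c s = 0"
    and diff: "\<And>s s'. s \<in> S \<Longrightarrow> s' \<in> S \<Longrightarrow> s - s' \<in> S"
    and S: "S \<subseteq> carrier_vec n" and v: "v \<in> carrier_vec n"
  shows "orth_proj S v = w"
  unfolding orth_proj_def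
proof (rule the_equality)
  fix w' assume w': "w' \<in> S \<and> (\<forall>s\<in>S. (v - w') \<bullet>c s = 0)"
  have carrier: "w \<in> carrier_vec n" "w' \<in> carrier_vec n"
    using w w' S by auto
  \<comment> \<open>The difference of two candidates lies in \<open>S\<close> and is orthogonal to
    \<open>S\<close>, hence to itself.\<close>
  define s where "s = w' - w"
  have s: "s \<in> S" "s \<in> carrier_vec n"
    unfolding s_def using w w' diff carrier by auto
  have "s = (v - w) - (v - w')"
    unfolding s_def using carrier v by auto
  then have "s \<bullet>c s = (v - w) \<bullet>c s - (v - w') \<bullet>c s"
    using minus_scalar_prod_distrib[of "v - w" n "v - w'" "conjugate s"] carrier v s by simp
  also have "\<dots> = 0"
    using w' orth s by simp
  finally have "s = 0\<^sub>v n"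
    using conjugate_square_eq_0_vec[OF s(2)] by simp
  then have "s $ i = 0" if "i < n" for i
    using that by simp
  then have "w' $ i = w $ i" if "i < n" for i
    using that carrier by (simp add: s_def)
  then show "w' = w"
    using carrier by (intro eq_vecI) auto
qed (use w orth in auto)

text \<open>Replaces the abstract span by a coordinate subspace, in which projection is
  truncation.\<close>

lemma span_unit_vec_subset:
  assumes J: "J \<subseteq> {..<n}"
  shows "LinearCombinations.module.span class_ring (module_vec TYPE(complex) n) (unit_vec n ` J) =
    {v \<in> carrier_vec n. \<forall>i<n. i \<notin> J \<longrightarrow> v $ i = 0}" (is "?L = ?R")
proof -
  interpret vec_space "TYPE(complex)" n .
  have sub: "unit_vec n ` J \<subseteq> carrier_vec n" and fin: "finite (unit_vec n ` J)"
    using J finite_subset[OF J] by auto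
  have L: "?L = {lincomb a (unit_vec n ` J) | a. a \<in> unit_vec n ` J \<rightarrow> UNIV}"
    using finite_span[OF fin] sub by simp
  have inj: "inj_on (unit_vec n :: nat \<Rightarrow> complex vec) J"
    using J by (auto simp: inj_on_def unit_vec_eq)
  have index: "lincomb a (unit_vec n ` J) $ i = (if i \<in> J then a (unit_vec n i) else 0)"
    if "i < n" for a i
  proof -
    have "lincomb a (unit_vec n ` J) $ i = (\<Sum>j\<in>J. a (unit_vec n j) * unit_vec n j $ i)"
      using lincomb_index[OF that sub] inj by (simp add: sum.reindex)
    also have "\<dots> = (\<Sum>j\<in>J. if j = i then a (unit_vec n i) else 0)"
      using that J by (intro sum.cong refl) auto
    finally show ?thesis
      using finite_subset[OF J] by simp
  qed
  show ?thesis
  proof (intro equalityI subsetI)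
    fix v assume "v \<in> ?L"
    then obtain a where v: "v = lincomb a (unit_vec n ` J)"
      unfolding L by auto
    have "v \<in> carrier_vec n"
      unfolding v using lincomb_closed[OF sub] by auto
    then show "v \<in> ?R"
      using index unfolding v by auto
  next
    fix v assume v: "v \<in> ?R"
    \<comment> \<open>Coefficients of a linear combination are indexed by vectors, so the position
      must be recovered from the unit vector; it is unique because unit vectors are
      distinct.\<close>
    define a where "a = (\<lambda>u :: complex vec. v $ (THE i. i < n \<and> u = unit_vec n i))"
    have a: "a (unit_vec n i) = v $ i" if "i < n" for i
    proof -
      have "(THE j. j < n \<and> unit_vec n i = (unit_vec n j :: complex vec)) = i"
        using that by (intro the_equality) (auto simp: unit_vec_eq)
      then show ?thesis
        by (simp add: a_def)
    qed
    have "lincomb a (unit_vec n ` J) \<in> carrier_vec n"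
      using lincomb_closed[OF sub] by auto
    then have "v = lincomb a (unit_vec n ` J)"
      using v index a by (intro eq_vecI) auto
    then show "v \<in> ?L"
      unfolding L by auto
  qed
qed

text \<open>The top eigenspace is a coordinate subspace, and the discarded part of \<open>v\<close>
  has support disjoint from it, so orthogonality holds term by term.\<close>

lemma orth_proj_top_space:
  assumes v: "v \<in> carrier_vec N"
  shows "orth_proj (top_space N (unit_vec N) \<theta>) v =
    vec N (\<lambda>j. if \<theta> j = theta_max N \<theta> then v $ j else 0)"
proof -
  let ?J = "{j. j < N \<and> \<theta> j = theta_max N \<theta>}"
  have image: "{unit_vec N j | j. j < N \<and> \<theta> j = theta_max N \<theta>} = unit_vec N ` ?J"
    by auto
  have S: "top_space N (unit_vec N) \<theta> =
      {v \<in> carrier_vec N. \<forall>i<N. i \<notin> ?J \<longrightarrow> v $ i = 0}"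
    unfolding top_space_def image by (rule span_unit_vec_subset) auto
  show ?thesis
    unfolding S using v
    by (intro orth_proj_eqI[where n = N]) (auto simp: scalar_prod_def intro!: sum.neutral)
qed

lemma sqnorm_orth_proj_ge:
  assumes v: "v \<in> carrier_vec N" and x: "x < N" and top: "\<theta> x = theta_max N \<theta>"
  shows "(cmod (v $ x))\<^sup>2 \<le> sqnorm (orth_proj (top_space N (unit_vec N) \<theta>) v)"
proof -
  let ?f = "\<lambda>j. (cmod (if \<theta> j = theta_max N \<theta> then v $ j else 0))\<^sup>2"
  have "?f x \<le> (\<Sum>j<N. ?f j)"
    using x by (intro member_le_sum) auto
  then show ?thesis
    unfolding orth_proj_top_space[OF v] sqnorm_def using top by simp
qed

section \<open>The advice unitary\<close>

definition householder :: "nat \<Rightarrow> (nat \<Rightarrow> real) \<Rightarrow> complex mat" where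
  "householder N w = mat N N (\<lambda>(i, j).
     of_real ((if i = j then 1 else 0) - 2 / (\<Sum>k<N. (w k)\<^sup>2) * w i * w j))"

text \<open>The matrix is the reflection I - 2 w w^T / |w|^2. It is real and symmetric, hence
  self-adjoint, and squares to the identity because c^2 |w|^2 = 2c cancels the mixed terms.\<close>

lemma unitary_householder: "unitary_mat N (householder N w)"
proof -
  let ?s = "\<Sum>k<N. (w k)\<^sup>2"
  define c where "c = 2 / ?s"
  let ?h = "\<lambda>i j. (if i = j then 1 else 0) - c * w i * w j"
  have H: "householder N w \<in> carrier_mat N N"
    by (simp add: householder_def)
  have adj: "mat_adjoint (householder N w) = householder N w"
    using mat_adjoint_index[OF H] mat_adjoint_carrier[OF H]
    by (intro eq_matI) (auto simp: householder_def)
  \<comment> \<open>Also valid when all weights vanish, because then \<open>c = 2 / 0 = 0\<close>.\<close>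
  have c: "c * c * ?s = 2 * c"
    by (cases "?s = 0") (auto simp: c_def)
  have "householder N w * householder N w = 1\<^sub>m N"
  proof (rule eq_matI)
    fix i j assume "i < dim_row (1\<^sub>m N :: complex mat)" "j < dim_col (1\<^sub>m N :: complex mat)"
    then have ij: "i < N" "j < N"
      by simp_all
    have "(householder N w * householder N w) $$ (i, j) = of_real (\<Sum>k<N. ?h i k * ?h k j)"
      using ij by (simp add: householder_def c_def scalar_prod_def lessThan_atLeast0)
    also have "(\<Sum>k<N. ?h i k * ?h k j) =
        (\<Sum>k<N. (if k = i then (if i = j then 1 else 0) - c * w i * w j else 0)
          - (if k = j then c * w i * w j else 0) + c * c * w i * w j * (w k)\<^sup>2)"
      by (intro sum.cong refl) (auto simp: algebra_simps power2_eq_square)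
    also have "\<dots> = (if i = j then 1 else 0) - 2 * c * w i * w j + (c * c * ?s) * w i * w j"
      using ij by (simp add: sum.distrib sum_subtractf sum_distrib_left[symmetric] algebra_simps)
    also have "\<dots> = (if i = j then 1 else 0)"
      unfolding c by simp
    finally show "(householder N w * householder N w) $$ (i, j) = 1\<^sub>m N $$ (i, j)"
      using ij by simp
  qed (simp_all add: householder_def)
  with H adj show ?thesis
    by (simp add: unitary_mat_def)
qed

text \<open>The reflection that exchanges the first basis state with a uniform superposition.\<close>

definition uniform_advice :: "nat \<Rightarrow> nat \<Rightarrow> complex mat" where
  "uniform_advice N K = householder N
     (\<lambda>i. (if i = 0 then 1 else 0) - (if i < K then 1 / sqrt K else 0))"

text \<open>For real unit vectors e and u, the reflection along w = e - u sends e to u because |w|^2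
  = 2 <w, e>. Here e is the first basis state, so <w, e> is \<open>?w 0\<close>.\<close>

lemma uniform_advice_state:
  assumes K: "0 < K" "K \<le> N" and x: "x < K"
  shows "(uniform_advice N K *\<^sub>v unit_vec N 0) $ x = of_real (1 / sqrt K)"
proof -
  let ?r = "1 / sqrt K"
  let ?w = "\<lambda>i. (if i = 0 then 1 else 0) - (if i < K then ?r else 0)"
  have r2: "?r\<^sup>2 = 1 / K"
    by (simp add: power_divide)
  have "(\<Sum>i<N. (?w i)\<^sup>2) = (\<Sum>i<N. (if i = 0 then 1 - 2 * ?r else 0) + (if i < K then ?r\<^sup>2 else 0))"
    using K by (intro sum.cong refl) (auto simp: power2_eq_square algebra_simps)
  also have "\<dots> = (1 - 2 * ?r) + (\<Sum>i<N. if i \<in> {..<K} then ?r\<^sup>2 else 0)"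
    using K by (simp add: sum.distrib)
  also have "(\<Sum>i<N. if i \<in> {..<K} then ?r\<^sup>2 else 0) = (\<Sum>i<K. ?r\<^sup>2)"
    using K by (subst sum.inter_restrict[symmetric]) (auto simp: Int_absorb1)
  also have "\<dots> = 1"
    unfolding r2 using K by simp
  finally have norm: "(\<Sum>i<N. (?w i)\<^sup>2) = 2 * ?w 0"
    using K by simp
  have "(uniform_advice N K *\<^sub>v unit_vec N 0) $ x = uniform_advice N K $$ (x, 0)"
    using K x by (simp add: uniform_advice_def householder_def scalar_prod_right_unit)
  also have "\<dots> = of_real ((if x = 0 then 1 else 0) - 2 / (2 * ?w 0) * ?w x * ?w 0)"
    using K x unfolding uniform_advice_def householder_def norm by simp
  also have "(if x = 0 then 1 else 0) - 2 / (2 * ?w 0) * ?w x * ?w 0 = ?r"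
  proof (cases "?w 0 = 0")
    \<comment> \<open>For K = 1 the vector w vanishes and the quotient defaults to 0, so the advice
      unitary is the identity and the entry is 1.\<close>
    case True
    then have "K = 1"
      using K by simp
    then show ?thesis
      using x by simp
  next
    case False
    have cancel: "2 / (2 * b) * a * b = a" if "b \<noteq> 0" for a b :: real
      using that by simp
    show ?thesis
      unfolding cancel[OF False] using x by simp
  qed
  finally show ?thesis .
qed

text \<open>Coordinate \<open>x\<close> alone contributes 1/K to the squared overlap, whichever
  \<open>x < K\<close> carries the top phase.\<close>

lemma valid_uniform_advice:
  assumes K: "0 < K" "K \<le> N" and \<gamma>: "\<gamma>\<^sup>2 \<le> 1 / K" and x: "x < K" and top: "\<theta> x = theta_max N \<theta>"
  shows "valid_advice N \<gamma> (unit_vec N) \<theta> (uniform_advice N K)"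
proof -
  have unitary: "unitary_mat N (uniform_advice N K)"
    unfolding uniform_advice_def by (rule unitary_householder)
  then have "uniform_advice N K *\<^sub>v unit_vec N 0 \<in> carrier_vec N"
    by (auto simp: unitary_mat_def intro!: mult_mat_vec_carrier)
  from sqnorm_orth_proj_ge[OF this _ top] x K
  have "(1 / sqrt K)\<^sup>2 \<le> sqnorm (orth_proj (top_space N (unit_vec N) \<theta>)
      (uniform_advice N K *\<^sub>v unit_vec N 0))"
    unfolding uniform_advice_state[OF K x] norm_of_real power2_abs by simp
  with \<gamma> unitary show ?thesis
    by (simp add: valid_advice_def power_divide)
qed

section \<open>Promise and correct outputs of single-phase inputs\<close>

lemma pi_ge_three: "3 \<le> pi"
  using sin_x_le_x[of "pi / 6"] by (simp add: sin_30)

text \<open>Covers both inputs to be compared: p = 0 is the identity, p = 3 delta its perturbation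
  at \<open>x\<close>.\<close>

lemma input_promise_single_phase:
  assumes x: "x < N" and \<delta>: "0 < \<delta>" "\<delta> < 1" and p: "0 \<le> p" "p \<le> 3 * \<delta>"
  shows "theta_max N (\<lambda>j. if j = x then p else 0) = p"
    and "input_promise N \<delta> (unit_vec N) (\<lambda>j. if j = x then p else 0)"
proof -
  show max: "theta_max N (\<lambda>j. if j = x then p else 0) = p"
    unfolding theta_max_def using x p by (intro Max_eqI) auto
  \<comment> \<open>The left side is at most 5 delta < 5 < 6 <= 2 pi.\<close>
  have "p + 2 * \<delta> < 2 * pi"
    using p \<delta> pi_ge_three by linarith
  moreover have "orthonormal_basis N (unit_vec N)"
    by (auto simp: orthonormal_basis_def scalar_prod_left_unit)
  ultimately show "input_promise N \<delta> (unit_vec N) (\<lambda>j. if j = x then p else 0)"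
    unfolding input_promise_def max using p \<delta> by auto
qed

lemma correct_outputs_disjoint:
  assumes "0 < \<delta>" "\<delta> < 1"
  shows "correct_outputs \<delta> (3 * \<delta>) \<inter> correct_outputs \<delta> 0 = {}"
proof -
  have False if k: "\<bar>x + 2 * pi * of_int k - 3 * \<delta>\<bar> \<le> \<delta>" and l: "\<bar>x + 2 * pi * of_int l - 0\<bar> \<le> \<delta>"
    for x and k l :: int
  proof -
    have "2 * pi * of_int (k - l) = 2 * pi * of_int k - 2 * pi * of_int l"
      by (simp add: algebra_simps)
    \<comment> \<open>The difference of the two shifted outputs lies in [delta, 5 delta], strictly
      between 0 and 2 pi, where there is no multiple of 2 pi.\<close>
    then have "0 < 2 * pi * of_int (k - l)" "2 * pi * of_int (k - l) < 2 * pi * 1"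
      using k l assms pi_ge_three by linarith+
    then have "0 < k - l" "k - l < 1"
      by (simp_all add: zero_less_mult_iff)
    then show False
      by simp
  qed
  then show ?thesis
    unfolding correct_outputs_def by blast
qed

section \<open>Assembling the lower bound\<close>

lemma output_prob_eq_outcome_weight:
  "output_prob N U A alg X = outcome_weight (measurement alg) X
     (run N (work_dim alg) U A (operations alg) (unit_vec (N * work_dim alg) 0))"
  unfolding output_prob_def outcome_weight_def final_state_def ..

text \<open>Each of the K perturbed inputs forces query mass at least 1 / (3 sqrt 18 delta) at its
  own position, while the masses over all K positions sum to at most sqrt K times the cost.\<close>

lemma maxQPE_known_cost:
  fixes N K :: nat
  assumes solves: "solves_maxQPE_known N \<delta> \<gamma> t alg"
    and \<delta>: "0 < \<delta>" "\<delta> < 1" and K: "0 < K" "K \<le> N" and \<gamma>: "\<gamma>\<^sup>2 \<le> 1 / K"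
  shows "sqrt K / (3 * sqrt 18 * \<delta>) \<le> cost alg"
proof -
  define m where "m = work_dim alg"
  define ops where "ops = operations alg"
  define A where "A = uniform_advice N K"
  define \<psi> where "\<psi> = (unit_vec (N * m) 0 :: complex vec)"
  define U0 where "U0 = diag_unitary N (\<lambda>_. 0)"
  define \<theta> where "\<theta> = (\<lambda>x j :: nat. if j = x then 3 * \<delta> else 0)"
  let ?M = "measurement alg"
  have ok: "0 < m" "\<forall>p\<in>set ops. operation_ok N m p" "is_povm (N * m) (map fst ?M)"
    using solves by (auto simp: solves_maxQPE_known_def solves_maxQPE_def algorithm_ok_def m_def ops_def)
  have A: "unitary_mat N A"
    unfolding A_def uniform_advice_def by (rule unitary_householder)
  have U0: "unitary_mat N U0"
    unfolding U0_def by (rule unitary_diag_unitary)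
  have \<psi>: "\<psi> \<in> carrier_vec (N * m)" "sqnorm \<psi> = 1"
    using K ok(1) by (simp_all add: \<psi>_def sqnorm_def unit_vec_def if_distrib[of cmod]
        if_distrib[of "\<lambda>a. a\<^sup>2"] cong: if_cong)
  have correct: "2 / 3 \<le> outcome_weight ?M (correct_outputs \<delta> p)
      (run N m (diag_unitary N (\<lambda>j. if j = x then p else 0)) A ops \<psi>)"
    if "x < K" "0 \<le> p" "p \<le> 3 * \<delta>" for x p
  proof -
    have "x < N"
      using that K by simp
    note promise = input_promise_single_phase[OF this \<delta> that(2,3)]
    have "valid_advice N \<gamma> (unit_vec N) (\<lambda>j. if j = x then p else 0) A"
      unfolding A_def using valid_uniform_advice[OF K \<gamma> that(1)] promise(1) by simp
    with promise solves show ?thesis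
      unfolding solves_maxQPE_known_def solves_maxQPE_def output_prob_eq_outcome_weight
        m_def ops_def \<psi>_def by fastforce
  qed
  have far: "1 / sqrt 18 \<le> 3 * \<delta> * query_mass N m U0 A x ops \<psi>" if x: "x < K" for x
  proof -
    let ?v = "run N m (diag_unitary N (\<theta> x)) A ops \<psi>"
    let ?w = "run N m U0 A ops \<psi>"
    have "2 / 3 \<le> outcome_weight ?M (correct_outputs \<delta> (3 * \<delta>)) ?v"
      unfolding \<theta>_def using correct[OF x, of "3 * \<delta>"] \<delta> by simp
    \<comment> \<open>With p = 0 the input is the identity for every \<open>x\<close>, so all K
      comparisons share one reference run.\<close>
    moreover have "2 / 3 \<le> outcome_weight ?M (correct_outputs \<delta> 0) ?w"
      unfolding U0_def using correct[OF x, of 0] \<delta> by (simp cong: if_cong)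
    moreover have "sqnorm ?w = 1"
      using sqnorm_run[OF ok(2) U0 A \<psi>(1)] \<psi>(2) by (rule trans)
    ultimately have "1 / 18 \<le> sqnorm (?v - ?w)"
      by (intro povm_distinguishes[OF ok(3) run_carrier[OF ok(2) \<psi>(1)] run_carrier[OF ok(2) \<psi>(1)]
            _ correct_outputs_disjoint[OF \<delta>]])
    then have "1 / sqrt 18 \<le> vnorm (?v - ?w)"
      using real_sqrt_le_mono[of "1 / 18" "sqnorm (?v - ?w)"] by (simp add: real_sqrt_divide)
    also have "\<dots> \<le> vnorm (\<psi> - \<psi>) + \<bar>\<theta> x x\<bar> * query_mass N m U0 A x ops \<psi>"
      unfolding U0_def using x K
      by (intro run_perturbation[OF ok(2) A \<psi>(1) \<psi>(1)]) (auto simp: \<theta>_def)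
    also have "\<dots> = 3 * \<delta> * query_mass N m U0 A x ops \<psi>"
      using \<psi>(1) \<delta> by (simp add: \<theta>_def sqnorm_def)
    finally show ?thesis .
  qed
  \<comment> \<open>Summing over K positions gives a factor K = sqrt K * sqrt K, of which
    Cauchy-Schwarz costs one sqrt K.\<close>
  have "sqrt K * (sqrt K * (1 / sqrt 18)) = K * (1 / sqrt 18)"
    by simp
  also have "\<dots> \<le> (\<Sum>x<K. 3 * \<delta> * query_mass N m U0 A x ops \<psi>)"
    using sum_bounded_below[of "{..<K}" "1 / sqrt 18"] far by simp
  also have "\<dots> = 3 * \<delta> * (\<Sum>x<K. query_mass N m U0 A x ops \<psi>)"
    by (simp add: sum_distrib_left)
  also have "\<dots> \<le> 3 * \<delta> * (cost alg * sqrt K)"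
    using sum_query_mass_le[OF ok(2) U0 A \<psi>(1) K(2)] \<psi>(2) \<delta>
    by (intro mult_left_mono) (simp_all add: cost_def ops_def)
  finally have "sqrt K * (sqrt K * (1 / sqrt 18)) \<le> sqrt K * (3 * \<delta> * cost alg)"
    by (simp add: mult_ac)
  then have "sqrt K * (1 / sqrt 18) \<le> 3 * \<delta> * cost alg"
    using K by (simp only: mult_le_cancel_left_pos real_sqrt_gt_zero of_nat_0_less_iff)
  then show ?thesis
    using \<delta> by (simp add: field_simps)
qed

lemma maxQPE_known_cost_ge:
  assumes solves: "solves_maxQPE_known N \<delta> \<gamma> t alg"
    and N: "2 \<le> N" and \<gamma>: "\<gamma> \<in> {1 / sqrt N..1}" and \<delta>: "\<delta> \<in> {0<..<1}"
  shows "1 / 18 / (\<gamma> * \<delta>) \<le> cost alg"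
proof -
  \<comment> \<open>The largest K with gamma^2 <= 1/K; the range of gamma ensures 1 <= K <=
    N.\<close>
  define K where "K = nat \<lfloor>1 / \<gamma>\<^sup>2\<rfloor>"
  have \<gamma>_pos: "0 < \<gamma>"
    using \<gamma> N by (auto intro: less_le_trans[of 0 "1 / sqrt N"])
  have ge1: "1 \<le> 1 / \<gamma>\<^sup>2"
    using \<gamma> \<gamma>_pos by (simp add: power_le_one)
  have "(1 / sqrt N)\<^sup>2 \<le> \<gamma>\<^sup>2"
    using \<gamma> by (intro power_mono) auto
  then have leN: "1 / \<gamma>\<^sup>2 \<le> N"
    using \<gamma>_pos N by (simp add: power_divide field_simps)
  have K: "0 < K" "real K \<le> 1 / \<gamma>\<^sup>2" "1 / \<gamma>\<^sup>2 < K + 1"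
    using ge1 unfolding K_def by linarith+
  then have "K \<le> N"
    using leN by linarith
  moreover have "\<gamma>\<^sup>2 \<le> 1 / K"
    using K \<gamma>_pos by (simp add: field_simps)
  ultimately have cost: "sqrt K / (3 * sqrt 18 * \<delta>) \<le> cost alg"
    using maxQPE_known_cost[OF solves _ _ K(1)] \<delta> by simp
  \<comment> \<open>From K >= 1 follows 1/gamma^2 < K + 1 <= 2K: rounding down loses at most a
    factor sqrt 2 in sqrt K.\<close>
  have "1 / (2 * \<gamma>\<^sup>2) \<le> K"
    using K by simp
  then have "sqrt (1 / (2 * \<gamma>\<^sup>2)) \<le> sqrt K"
    by (rule real_sqrt_le_mono)
  then have "1 / (sqrt 2 * \<gamma>) \<le> sqrt K"
    using \<gamma>_pos by (simp add: real_sqrt_divide real_sqrt_mult)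
  then have "1 / (sqrt 2 * \<gamma>) / (3 * sqrt 18 * \<delta>) \<le> sqrt K / (3 * sqrt 18 * \<delta>)"
    using \<delta> by (intro divide_right_mono) auto
  \<comment> \<open>The rounding loss and the measurement constant combine to 6, and with the phase
    factor 3 to 18.\<close>
  moreover have "sqrt 2 * sqrt 18 = sqrt (6\<^sup>2)"
    by (simp only: real_sqrt_mult[symmetric]) simp
  then have "sqrt 2 * sqrt 18 = 6"
    by simp
  moreover have "1 / (sqrt 2 * \<gamma>) / (3 * sqrt 18 * \<delta>) = 1 / (3 * (sqrt 2 * sqrt 18) * (\<gamma> * \<delta>))"
    by (simp add: mult_ac)
  ultimately show ?thesis
    using cost by (simp only:) simp
qed

text \<open>The computational basis is one of the bases an algorithm for the unknown case must
  handle.\<close>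

lemma solves_maxQPE_known_if_unknown:
  "solves_maxQPE_unknown N \<delta> \<gamma> t alg \<Longrightarrow> solves_maxQPE_known N \<delta> \<gamma> t alg"
  by (simp add: solves_maxQPE_unknown_def solves_maxQPE_known_def solves_maxQPE_def)

theorem lemma3p6:
  shows "\<forall>a::real. a > 0 \<longrightarrow> (\<exists>c::real. c > 0 \<and>
    (\<forall>(N::nat) (\<gamma>::real) (\<delta>::real) (t::nat).
       N \<ge> 2 \<and> \<gamma> \<in> {1 / sqrt (real N)..1} \<and> \<delta> \<in> {0<..<1} \<and> real t \<ge> a / \<gamma> \<longrightarrow>
       (\<forall>alg. solves_maxQPE_known N \<delta> \<gamma> t alg \<longrightarrow> real (cost alg) \<ge> c / (\<gamma> * \<delta>)) \<and>
       (\<forall>alg. solves_maxQPE_unknown N \<delta> \<gamma> t alg \<longrightarrow> real (cost alg) \<ge> c / (\<gamma> * \<delta>))))"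
  using maxQPE_known_cost_ge solves_maxQPE_known_if_unknown
  by (intro allI impI exI[of _ "1 / 18"] conjI) (blast | simp)+

end
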